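(* Let $d\ge1$, $p\ge 1$, $E\ge 0$ be integers, and let $\mathbf{X}$ be a $d$-dimensional random vector with probability density $f_{\mathbf{X}}$. Let $B_{\mathbf{i}}$ be the floating-point quantization bins, $p_{\mathbf{i}}=\mathbb{P}\{\mathbf{X}\in B_{\mathbf{i}}\}$, and $g$, $g_{\mathbf{i}}$, $R_{\mathbf{i}}$, $L_{\mathbf{i}}$ as defined in the context. Assume that for every $\mathbf{i}$ with $p_{\mathbf{i}}>0$, $$\Lambda_{\mathbf{i}} := \operatorname*{ess\,sup}_{\mathbf{x}\in B_{\mathbf{i}}} R_{\mathbf{i}}(\mathbf{x}) = \frac{1}{g_{\mathbf{i}}}\operatorname*{ess\,sup}_{\mathbf{x}\in B_{\mathbf{i}}} f_{\mathbf{X}}(\mathbf{x})<\infty .$$ Then $$\sum_{\mathbf{i}} p_{\mathbf{i}}\max_{\lambda\ge 1}\bigl[\lambda\log\lambda-(\lambda-1)\log e\bigr]L_{\mathbf{i}}(\lambda)\;\le\; D(f_{\mathbf{X}}\|g)\;\le\;\sum_{\mathbf{i}} p_{\mathbf{i}}\int_1^{\Lambda_{\mathbf{i}}}(\log\lambda+\log e)\,L_{\mathbf{i}}(\lambda)\,d\lambda,$$ where the sums run over the indices $\mathbf{i}$ with $p_{\mathbf{i}}>0$, and in the left-hand sum the maximum is of the product $[\lambda\log\lambda-(\lambda-1)\log e]\,L_{\mathbf{i}}(\lambda)$.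
   Context: All logarithms are base 2, and $0\log 0=0$. Let $e_{min}=-(2^{E-1}-1)$ and $e_{max}=2^{E-1}$. The representable values $u_1<u_2<\dots<u_K$, $K=2^{E+p}$, are the numbers $\pm 2^{e}(1+m2^{-(p-1)})$ with $e\in\{e_{min},e_{min}+1,\dots,e_{max}\}$ ($2^E$ exponent values) and $m\in\{0,1,\dots,2^{p-1}-1\}$. The granular region is $\mathbb{U}=[-2^{e_{max}+1}+2^{e_{max}-p},\,2^{e_{max}+1}-2^{e_{max}-p}]$. Bin boundaries: $a_1=-2^{e_{max}+1}+2^{e_{max}-p}$, $a_i=\frac{u_i+u_{i-1}}{2}$ for $2\le i\le K$; $b_i=\frac{u_{i+1}+u_i}{2}$ for $1\le i\le K-1$, $b_K=2^{e_{max}+1}-2^{e_{max}-p}$. For $\mathbf{i}=(i_1,\dots,i_d)\in\{1,\dots,K\}^d$, the quantization bin is $B_{\mathbf{i}}=\prod_{j=1}^d[a_{i_j},b_{i_j}]$; $|\cdot|$ of a set denotes Lebesgue measure; bins overlap only on null sets and cover $\mathbb{U}^d$. Define $g(\mathbf{x})=\sum_{\mathbf{i}}\frac{p_{\mathbf{i}}}{|B_{\mathbf{i}}|}\mathbf{1}_{\{\mathbf{x}\in B_{\mathbf{i}}\}}$. For $\mathbf{i}$ with $p_{\mathbf{i}}>0$, let $g_{\mathbf{i}}=p_{\mathbf{i}}/|B_{\mathbf{i}}|$ (the value of $g$ on $B_{\mathbf{i}}$), $R_{\mathbf{i}}(\mathbf{x})=f_{\mathbf{X}}(\mathbf{x})/g_{\mathbf{i}}$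 for $\mathbf{x}\in B_{\mathbf{i}}$, and for $\lambda>0$, $L_{\mathbf{i}}(\lambda)=\frac{1}{|B_{\mathbf{i}}|}\,|\{\mathbf{x}\in B_{\mathbf{i}}: R_{\mathbf{i}}(\mathbf{x})\ge\lambda\}|$. The divergence is $D(f_{\mathbf{X}}\|g)=\int_{\mathbb{U}^d} f_{\mathbf{X}}(\mathbf{x})\log\frac{f_{\mathbf{X}}(\mathbf{x})}{g(\mathbf{x})}\,d\mathbf{x}$. *)

theory Defs
  imports "HOL-Probability.Probability"
begin

(* The exponents are kept real: for E = 0 one gets e_min = e_max = 1/2. *)
definition e_min :: "nat \<Rightarrow> real" where
  "e_min E = - (2 powr (real E - 1) - 1)"

definition e_max :: "nat \<Rightarrow> real" where
  "e_max E = 2 powr (real E - 1)"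

definition exponents :: "nat \<Rightarrow> real set" where
  "exponents E = {e_min E + real k | k::nat. e_min E + real k \<le> e_max E}"

definition fp_values :: "nat \<Rightarrow> nat \<Rightarrow> real set" where
  "fp_values E p =
     {s * (2 powr e * (1 + real m * 2 powr (- (real p - 1)))) | s e m.
        s \<in> {-1, 1} \<and> e \<in> exponents E \<and> m \<in> {0..<2 ^ (p - 1)}}"

definition fp_count :: "nat \<Rightarrow> nat \<Rightarrow> nat" where
  "fp_count E p = 2 ^ (E + p)"

(* 1-based increasing enumeration of the representable values. *)
definition fp_value :: "nat \<Rightarrow> nat \<Rightarrow> nat \<Rightarrow> real" where
  "fp_value E p i = sorted_list_of_set (fp_values E p) ! (i - 1)"

definition granular_max :: "nat \<Rightarrow> nat \<Rightarrow> real" where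
  "granular_max E p = 2 powr (e_max E + 1) - 2 powr (e_max E - real p)"

definition granular_region :: "nat \<Rightarrow> nat \<Rightarrow> real set" where
  "granular_region E p = {- granular_max E p .. granular_max E p}"

definition granular_box :: "nat \<Rightarrow> nat \<Rightarrow> (real ^ 'n) set" where
  "granular_box E p = {x. \<forall>j. x $ j \<in> granular_region E p}"

definition bin_lower :: "nat \<Rightarrow> nat \<Rightarrow> nat \<Rightarrow> real" where
  "bin_lower E p i =
     (if i = 1 then - granular_max E p
      else (fp_value E p i + fp_value E p (i - 1)) / 2)"

definition bin_upper :: "nat \<Rightarrow> nat \<Rightarrow> nat \<Rightarrow> real" where
  "bin_upper E p i =
     (if i = fp_count E p then granular_max E p
      else (fp_value E p (i + 1) + fp_value E p i) / 2)"

definition bin_indices :: "nat \<Rightarrow> nat \<Rightarrow> ('n \<Rightarrow> nat) set" where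
  "bin_indices E p = {i. \<forall>j. i j \<in> {1..fp_count E p}}"

definition fp_bin :: "nat \<Rightarrow> nat \<Rightarrow> ('n \<Rightarrow> nat) \<Rightarrow> (real ^ 'n) set" where
  "fp_bin E p i = {x. \<forall>j. x $ j \<in> {bin_lower E p (i j) .. bin_upper E p (i j)}}"

definition bin_prob ::
    "'a measure \<Rightarrow> ('a \<Rightarrow> real ^ 'n) \<Rightarrow> nat \<Rightarrow> nat \<Rightarrow> ('n \<Rightarrow> nat) \<Rightarrow> real" where
  "bin_prob M X E p i = \<P>(\<omega> in M. X \<omega> \<in> fp_bin E p i)"

definition active_indices ::
    "'a measure \<Rightarrow> ('a \<Rightarrow> real ^ 'n) \<Rightarrow> nat \<Rightarrow> nat \<Rightarrow> ('n \<Rightarrow> nat) set" where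
  "active_indices M X E p = {i \<in> bin_indices E p. bin_prob M X E p i > 0}"

definition bin_density ::
    "'a measure \<Rightarrow> ('a \<Rightarrow> real ^ 'n) \<Rightarrow> nat \<Rightarrow> nat \<Rightarrow> ('n \<Rightarrow> nat) \<Rightarrow> real" where
  "bin_density M X E p i = bin_prob M X E p i / measure lborel (fp_bin E p i)"

definition quantized_density ::
    "'a measure \<Rightarrow> ('a \<Rightarrow> real ^ 'n) \<Rightarrow> nat \<Rightarrow> nat \<Rightarrow> real ^ 'n \<Rightarrow> real" where
  "quantized_density M X E p x =
     (\<Sum>i\<in>bin_indices E p. bin_density M X E p i * indicator (fp_bin E p i) x)"

definition density_ratio ::
    "'a measure \<Rightarrow> ('a \<Rightarrow> real ^ 'n) \<Rightarrow> (real ^ 'n \<Rightarrow> real) \<Rightarrow> nat \<Rightarrow> nat \<Rightarrow>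
     ('n \<Rightarrow> nat) \<Rightarrow> real ^ 'n \<Rightarrow> real" where
  "density_ratio M X f E p i x = f x / bin_density M X E p i"

definition ratio_tail ::
    "'a measure \<Rightarrow> ('a \<Rightarrow> real ^ 'n) \<Rightarrow> (real ^ 'n \<Rightarrow> real) \<Rightarrow> nat \<Rightarrow> nat \<Rightarrow>
     ('n \<Rightarrow> nat) \<Rightarrow> real \<Rightarrow> real" where
  "ratio_tail M X f E p i t =
     measure lborel {x \<in> fp_bin E p i. density_ratio M X f E p i x \<ge> t}
       / measure lborel (fp_bin E p i)"

definition ratio_esssup ::
    "'a measure \<Rightarrow> ('a \<Rightarrow> real ^ 'n) \<Rightarrow> (real ^ 'n \<Rightarrow> real) \<Rightarrow> nat \<Rightarrow> nat \<Rightarrow>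
     ('n \<Rightarrow> nat) \<Rightarrow> ereal" where
  "ratio_esssup M X f E p i =
     esssup (restrict_space lborel (fp_bin E p i))
       (\<lambda>x. ereal (density_ratio M X f E p i x))"

(* The convention 0 log 0 = 0 holds because the factor f x vanishes. *)
definition divergence_integrand ::
    "(real ^ 'n \<Rightarrow> real) \<Rightarrow> (real ^ 'n \<Rightarrow> real) \<Rightarrow> real ^ 'n \<Rightarrow> real" where
  "divergence_integrand f g x = f x * log 2 (f x / g x)"

definition divergence ::
    "(real ^ 'n) set \<Rightarrow> (real ^ 'n \<Rightarrow> real) \<Rightarrow> (real ^ 'n \<Rightarrow> real) \<Rightarrow> real" where
  "divergence A f g = (LINT x:A|lborel. divergence_integrand f g x)"

definition is_max_at :: "('a \<Rightarrow> real) \<Rightarrow> 'a set \<Rightarrow> 'a \<Rightarrow> bool" where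
  "is_max_at h A t \<longleftrightarrow> t \<in> A \<and> (\<forall>s\<in>A. h s \<le> h t)"

(* The maximum of h over A; unspecified unless it is attained (see is_max_at). *)
definition max_over :: "('a \<Rightarrow> real) \<Rightarrow> 'a set \<Rightarrow> real" where
  "max_over h A = (GREATEST v. v \<in> h ` A)"

definition lower_objective ::
    "'a measure \<Rightarrow> ('a \<Rightarrow> real ^ 'n) \<Rightarrow> (real ^ 'n \<Rightarrow> real) \<Rightarrow> nat \<Rightarrow> nat \<Rightarrow>
     ('n \<Rightarrow> nat) \<Rightarrow> real \<Rightarrow> real" where
  "lower_objective M X f E p i t =
     (t * log 2 t - (t - 1) * log 2 (exp 1)) * ratio_tail M X f E p i t"

definition upper_integrand ::
    "'a measure \<Rightarrow> ('a \<Rightarrow> real ^ 'n) \<Rightarrow> (real ^ 'n \<Rightarrow> real) \<Rightarrow> nat \<Rightarrow> nat \<Rightarrow>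
     ('n \<Rightarrow> nat) \<Rightarrow> real \<Rightarrow> real" where
  "upper_integrand M X f E p i t =
     (log 2 t + log 2 (exp 1)) * ratio_tail M X f E p i t"

end

theory Submission
  imports Defs
begin

text \<open>
  On a bin \<open>B\<close> with the uniform distribution, the ratio \<open>R = f / g\<close> is a nonnegative random variable
  with mean \<open>1\<close>, tail function \<open>L\<close> and essential supremum \<open>\<Lambda>\<close>, and the bin contributes
  \<open>p E[R log R]\<close> to the divergence.  Since \<open>E[R] = 1\<close>, subtracting from \<open>t log t\<close> its tangent line at \<open>1\<close>
  does not change the expectation; the resulting function is nonnegative, and nondecreasing on
  \<open>[1, \<infinity>)\<close>, so Markov's inequality gives the lower bound.  For the upper bound, drop the region \<open>R < 1\<close>,
  where \<open>R log R \<le> 0\<close>, and integrate the derivative \<open>log t + log e\<close> of \<open>t log t\<close> against \<open>L\<close>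
  by Fubini's theorem.
\<close>

section \<open>Bounds on the entropy of a bounded ratio\<close>

text \<open>Convexity of t ln t: the left-hand side is its tangent line at s. It comes from ln u <=
  u - 1 at u = s / t, multiplied by t, which leaves t = 0 as a separate case.\<close>

lemma ln_mult_self_ge:
  fixes s t :: real
  assumes "0 \<le> t" "0 < s"
  shows "t * ln s + t - s \<le> t * ln t"
proof (cases "t = 0")
  case False
  then have "ln (s / t) \<le> s / t - 1"
    using assms by (intro ln_le_minus_one) auto
  then have "t * ln (s / t) \<le> t * (s / t - 1)"
    using assms by (intro mult_left_mono) auto
  with False assms show ?thesis
    by (simp add: ln_div algebra_simps)
qed (use assms in auto)

text \<open>The height of t log t above its tangent line at 1, to base 2. This is the bracket in the
  lower bound.\<close>

definition entropy_gap :: "real \<Rightarrow> real" where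
  "entropy_gap t = t * log 2 t - (t - 1) * log 2 (exp 1)"

lemma entropy_gap_eq: "entropy_gap t = (t * ln t - t + 1) / ln 2"
  by (simp add: entropy_gap_def log_def field_simps)

lemma entropy_gap_nonneg: "0 \<le> t \<Longrightarrow> 0 \<le> entropy_gap t"
  using ln_mult_self_ge[of t 1] by (simp add: entropy_gap_eq)

text \<open>The tangent inequality at s shows that the gap grows from s to t by at least (t - s) log
  s, which is nonnegative for s >= 1.\<close>

lemma entropy_gap_mono:
  assumes "1 \<le> s" "s \<le> t"
  shows "entropy_gap s \<le> entropy_gap t"
proof -
  have "0 \<le> (t - s) * ln s"
    using assms by simp
  with ln_mult_self_ge[of t s] assms show ?thesis
    by (simp add: entropy_gap_eq divide_right_mono algebra_simps)
qed

lemma continuous_on_entropy_gap: "continuous_on {1..} entropy_gap"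
  unfolding entropy_gap_def[abs_def] by (intro continuous_intros) auto

text \<open>Monotonicity and left continuity make \<open>L\<close> upper semicontinuous.\<close>

lemma mult_antimono_attains_max:
  fixes \<psi> L :: "real \<Rightarrow> real"
  assumes \<psi>: "continuous_on {a..} \<psi>" "\<And>t. a \<le> t \<Longrightarrow> 0 \<le> \<psi> t"
    and L: "antimono L" "\<And>t. 0 \<le> L t" "\<And>t. continuous (at_left t) L"
    and vanish: "\<And>t. r < t \<Longrightarrow> L t = 0"
  shows "\<exists>t. is_max_at (\<lambda>t. \<psi> t * L t) {a..} t"
proof -
  define h where "h t = \<psi> t * L t" for t
  \<comment> \<open>Beyond r the product vanishes, so a maximizer can be sought in this compact
    interval; the outer max keeps it nonempty when r < a.\<close>
  define J where "J = {a..max a r}"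
  have J: "compact J" "J \<noteq> {}" "J \<subseteq> {a..}"
    by (auto simp: J_def)
  then have \<psi>J: "continuous_on J \<psi>"
    using \<psi>(1) continuous_on_subset by blast
  obtain m where m: "\<And>t. t \<in> J \<Longrightarrow> \<psi> t \<le> \<psi> m" "m \<in> J"
    using continuous_attains_sup[OF J(1,2) \<psi>J] by blast
  have "h t \<le> \<psi> m * L a" if "t \<in> J" for t
    unfolding h_def using that m(1)[OF that] m(2) J(3) \<psi>(2) L(2) antimonoD[OF L(1), of a t]
    by (intro mult_mono) (auto simp: J_def)
  then have bdd: "bdd_above (h ` J)"
    by (auto simp: bdd_above_def)
  define S where "S = (SUP t\<in>J. h t)"
  have "\<exists>t\<in>J. S - inverse (real (Suc n)) < h t" for n
    using less_cSUP_iff[OF J(2) bdd, of "S - inverse (real (Suc n))"]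
    by (simp add: S_def)
  \<comment> \<open>A maximizing sequence; compactness gives a subsequence converging to the future
    maximizer l.\<close>
  then obtain t where t: "\<And>n. t n \<in> J" "\<And>n. S - inverse (real (Suc n)) < h (t n)"
    by metis
  from J(1) t(1) obtain l k where l: "l \<in> J" "strict_mono k" "(t \<circ> k) \<longlonglongrightarrow> l"
    unfolding compact_def by metis
  \<comment> \<open>The subsequence eventually exceeds any s < l, so there L is at most L s. With L
    s fixed, the limit uses only continuity of \<open>\<psi>\<close>.\<close>
  have below: "S \<le> \<psi> l * L s" if "s < l" for s
  proof (rule LIMSEQ_le)
    have "(\<lambda>n. S - inverse (real (Suc n))) \<longlonglongrightarrow> S - 0"
      by (intro tendsto_intros LIMSEQ_inverse_real_of_nat)
    from LIMSEQ_subseq_LIMSEQ[OF this l(2)]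
    show "(\<lambda>n. S - inverse (real (Suc (k n)))) \<longlonglongrightarrow> S"
      by (simp add: o_def)
    have "(\<lambda>n. \<psi> (t (k n))) \<longlonglongrightarrow> \<psi> l"
      using continuous_on_tendsto_compose[OF \<psi>J l(3) l(1)] t(1) by (simp add: o_def)
    then show "(\<lambda>n. \<psi> (t (k n)) * L s) \<longlonglongrightarrow> \<psi> l * L s"
      by (intro tendsto_intros)
    have "\<forall>\<^sub>F n in sequentially. s < t (k n)"
      using order_tendstoD(1)[OF l(3) that] by (simp add: o_def)
    then obtain N where N: "\<And>n. N \<le> n \<Longrightarrow> s < t (k n)"
      unfolding eventually_sequentially by blast
    have "S - inverse (real (Suc (k n))) \<le> \<psi> (t (k n)) * L s" if "N \<le> n" for n
    proof -
      have "h (t (k n)) \<le> \<psi> (t (k n)) * L s"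
        unfolding h_def using N[OF that] t(1) J(3)
        by (intro mult_left_mono \<psi>(2) antimonoD[OF L(1)]) auto
      with t(2)[of "k n"] show ?thesis by simp
    qed
    then show "\<exists>N. \<forall>n\<ge>N. S - inverse (real (Suc (k n))) \<le> \<psi> (t (k n)) * L s"
      by blast
  qed
  \<comment> \<open>Let s tend to l from the left and use left continuity of L.\<close>
  have S: "S \<le> h l"
  proof (rule tendsto_lowerbound)
    show "((\<lambda>s. \<psi> l * L s) \<longlongrightarrow> h l) (at_left l)"
      using L(3)[of l] unfolding h_def continuous_within by (intro tendsto_intros)
    show "\<forall>\<^sub>F s in at_left l. S \<le> \<psi> l * L s"
      by (rule eventually_at_leftI[of "l - 1"]) (auto intro: below)
  qed simp
  have "h s \<le> h l" if "a \<le> s" for s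
  proof (cases "s \<in> J")
    case True
    then have "h s \<le> S"
      unfolding S_def by (intro cSUP_upper bdd)
    with S show ?thesis by simp
  next
    case False
    with that have "h s = 0"
      using vanish[of s] by (auto simp: J_def h_def)
    moreover have "0 \<le> h l"
      using l(1) J(3) \<psi>(2) L(2) by (auto simp: h_def)
    ultimately show ?thesis by simp
  qed
  with l(1) J(3) show ?thesis
    by (auto simp: is_max_at_def h_def)
qed

lemma DERIV_entropy:
  assumes "0 < t"
  shows "((\<lambda>t. t * log 2 t) has_real_derivative log 2 t + log 2 (exp 1)) (at t)"
  unfolding log_def using assms by (auto intro!: derivative_eq_intros simp: field_simps)

text \<open>The antiderivative t log t vanishes at 1. The integral is stated in
  \<open>ennreal\<close> so that Tonelli's theorem applies to it later.\<close>

lemma nn_integral_entropy_deriv: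
  assumes "1 \<le> y"
  shows "(\<integral>\<^sup>+t. ennreal (log 2 t + log 2 (exp 1)) * indicator {1..y} t \<partial>lborel) = ennreal (y * log 2 y)"
proof -
  have "(\<integral>\<^sup>+t. ennreal (log 2 t + log 2 (exp 1)) * indicator {1..y} t \<partial>lborel) =
      ennreal (y * log 2 y - 1 * log 2 1)"
  proof (rule nn_integral_FTC_Icc)
    have "0 \<le> log 2 (exp 1 :: real)"
      by (simp add: log_def)
    then show "0 \<le> log 2 t + log 2 (exp 1)" if "t \<in> {1..y}" for t
      using that by (intro add_nonneg_nonneg) auto
  qed (use assms in \<open>auto intro!: DERIV_entropy simp del: log_exp\<close>)
  then show ?thesis
    by simp
qed

lemma max_over_eq:
  assumes "is_max_at h A t"
  shows "max_over h A = h t"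
  unfolding max_over_def
  using assms by (intro Greatest_equality) (auto simp: is_max_at_def)

section \<open>Tails and entropy of a bounded random variable\<close>

context prob_space
begin

lemma antimono_tail:
  assumes [measurable]: "R \<in> borel_measurable M"
  shows "antimono (\<lambda>t::real. prob {x \<in> space M. t \<le> R x})"
  by (intro antimonoI finite_measure_mono) auto

text \<open>Reflection: the tail of R at s is the distribution function of -R at -s, and
  distribution functions are right continuous.\<close>

lemma left_continuous_tail:
  assumes [measurable]: "R \<in> borel_measurable M"
  shows "continuous (at_left t) (\<lambda>t::real. prob {x \<in> space M. t \<le> R x})"
proof -
  interpret N: prob_space "distr M borel (\<lambda>x. - R x)"
    by (rule prob_space_distr) simp
  interpret N: finite_borel_measure "distr M borel (\<lambda>x. - R x)"
    by unfold_locales auto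
  have eq: "prob {x \<in> space M. s \<le> R x} = cdf (distr M borel (\<lambda>x. - R x)) (- s)" for s
    unfolding cdf_def by (subst measure_distr) (auto intro!: arg_cong[where f=prob])
  have "((\<lambda>s. cdf (distr M borel (\<lambda>x. - R x)) (- s)) \<longlongrightarrow> cdf (distr M borel (\<lambda>x. - R x)) (- t)) (at_left t)"
    using N.cdf_is_right_cont[of "- t"] unfolding continuous_within at_left_minus[of t]
    by (simp add: filterlim_filtermap)
  then show ?thesis
    by (simp add: continuous_within eq)
qed

lemma tail_eq_0:
  assumes [measurable]: "R \<in> borel_measurable M"
    and R: "AE x in M. R x \<le> r" "r < (t::real)"
  shows "prob {x \<in> space M. t \<le> R x} = 0"
proof -
  have "AE x in M. x \<notin> {x \<in> space M. t \<le> R x}"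
    using R(1) by eventually_elim (use R(2) in auto)
  then show ?thesis
    by (subst prob_eq_0) auto
qed

lemma integrable_entropy:
  assumes [measurable]: "R \<in> borel_measurable M"
    and R: "\<And>x. 0 \<le> R x" "AE x in M. R x \<le> r"
  shows "integrable M (\<lambda>x. R x * log 2 (R x))"
proof (rule integrable_const_bound)
  \<comment> \<open>Below: nonnegativity of the gap gives t log t >= (t - 1) log e >= - log e.
    Above: t log t increases on [1, r] and is nonpositive on [0, 1]; \<open>max 1 r\<close> covers r
    < 1.\<close>
  show "AE x in M. norm (R x * log 2 (R x)) \<le> max (log 2 (exp 1)) (r * log 2 (max 1 r))"
    using R(2)
  proof eventually_elim
    case (elim x)
    have "0 \<le> R x * log 2 (exp 1)"
      using R(1)[of x] by (simp add: log_def)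
    then have "- log 2 (exp 1) \<le> R x * log 2 (R x)"
      using entropy_gap_nonneg[OF R(1)[of x]]
      by (simp add: entropy_gap_def algebra_simps diff_divide_distrib)
    moreover have "R x * log 2 (R x) \<le> r * log 2 (max 1 r)"
    proof (cases "1 \<le> R x")
      case True
      with elim show ?thesis by (intro mult_mono) auto
    next
      case False
      then have "R x * log 2 (R x) \<le> 0"
        using R(1)[of x] by (cases "R x = 0") (auto simp: mult_le_0_iff log_le_zero_cancel_iff)
      also have "0 \<le> r * log 2 (max 1 r)"
        using elim R(1)[of x] by auto
      finally show ?thesis .
    qed
    ultimately show ?case
      by auto
  qed
qed measurable

lemma entropy_gap_tail_le:
  assumes [measurable]: "R \<in> borel_measurable M"
    and R: "\<And>x. 0 \<le> R x" "AE x in M. R x \<le> r" "integrable M R" "expectation R = 1"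
    and "1 \<le> t"
  shows "entropy_gap t * prob {x \<in> space M. t \<le> R x} \<le> expectation (\<lambda>x. R x * log 2 (R x))"
proof -
  note int = integrable_entropy[OF assms(1) R(1,2)]
  have "entropy_gap t * prob {x \<in> space M. t \<le> R x}
      = (\<integral>x. entropy_gap t * indicator {x \<in> space M. t \<le> R x} x \<partial>M)"
    by simp
  also have "\<dots> \<le> (\<integral>x. entropy_gap (R x) \<partial>M)"
  proof (rule integral_mono)
    show "integrable M (\<lambda>x. entropy_gap (R x))"
      unfolding entropy_gap_def using int R(3) by auto
    \<comment> \<open>Markov's argument: monotonicity handles the points with R x >= t,
      nonnegativity all others.\<close>
    show "entropy_gap t * indicator {x \<in> space M. t \<le> R x} x \<le> entropy_gap (R x)" for x
      using entropy_gap_mono[OF \<open>1 \<le> t\<close>, of "R x"] entropy_gap_nonneg[OF R(1)[of x]]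
      by (auto simp: indicator_def)
    show "integrable M (\<lambda>x. entropy_gap t * indicator {x \<in> space M. t \<le> R x} x)"
      by (intro integrable_mult_right integrable_real_indicator) (auto simp: less_top[symmetric])
  qed
  \<comment> \<open>The tangent line contributes (E[R] - 1) log e = 0.\<close>
  also have "\<dots> = expectation (\<lambda>x. R x * log 2 (R x))"
    unfolding entropy_gap_def using int R(3,4) by (simp add: prob_space)
  finally show ?thesis .
qed

text \<open>Layer-cake formula: the integrand is the integral of the derivative of t log t from 1 to
  \<open>max 1 (R x)\<close>, and Tonelli's theorem swaps the two integrals. The truncation makes
  the part R < 1 contribute zero.\<close>

lemma nn_integral_entropy_layer_cake:
  assumes [measurable]: "R \<in> borel_measurable M"
  shows "(\<integral>\<^sup>+x. ennreal (max 1 (R x) * log 2 (max 1 (R x))) \<partial>M) =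
    (\<integral>\<^sup>+t. ennreal ((log 2 t + log 2 (exp 1)) * prob {x \<in> space M. t \<le> R x}) * indicator {1<..} t \<partial>lborel)"
proof -
  interpret P: pair_sigma_finite M lborel
    by (intro pair_sigma_finite.intro sigma_finite_lborel) unfold_locales
  have "(\<integral>\<^sup>+x. ennreal (max 1 (R x) * log 2 (max 1 (R x))) \<partial>M) =
      (\<integral>\<^sup>+x. (\<integral>\<^sup>+t. ennreal (log 2 t + log 2 (exp 1)) * indicator {1..max 1 (R x)} t \<partial>lborel) \<partial>M)"
    by (simp only: nn_integral_entropy_deriv max.cobounded1)
  also have "\<dots> = (\<integral>\<^sup>+x. (\<integral>\<^sup>+t. ennreal (log 2 t + log 2 (exp 1)) * indicator {1<..} t
      * indicator {x \<in> space M. t \<le> R x} x \<partial>lborel) \<partial>M)"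
  \<comment> \<open>The two integrands can differ only at t = 1, a null set.\<close>
  proof (rule nn_integral_cong, rule nn_integral_cong_AE)
    fix x assume "x \<in> space M"
    show "AE t in lborel. ennreal (log 2 t + log 2 (exp 1)) * indicator {1..max 1 (R x)} t =
        ennreal (log 2 t + log 2 (exp 1)) * indicator {1<..} t * indicator {x \<in> space M. t \<le> R x} x"
      using AE_lborel_singleton[of 1]
      by eventually_elim (use \<open>x \<in> space M\<close> in \<open>auto simp: indicator_def max_def\<close>)
  qed
  also have "\<dots> = (\<integral>\<^sup>+t. (\<integral>\<^sup>+x. ennreal (log 2 t + log 2 (exp 1)) * indicator {1<..} t
      * indicator {x \<in> space M. t \<le> R x} x \<partial>M) \<partial>lborel)"
    by (rule P.Fubini'[symmetric]) measurable
  also have "\<dots> = (\<integral>\<^sup>+t. ennreal ((log 2 t + log 2 (exp 1)) * prob {x \<in> space M. t \<le> R x})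
      * indicator {1<..} t \<partial>lborel)"
  proof (rule nn_integral_cong)
    fix t :: real
    have "(\<integral>\<^sup>+x. ennreal (log 2 t + log 2 (exp 1)) * indicator {1<..} t
        * indicator {x \<in> space M. t \<le> R x} x \<partial>M)
        = ennreal (log 2 t + log 2 (exp 1)) * indicator {1<..} t * ennreal (prob {x \<in> space M. t \<le> R x})"
      by (subst nn_integral_cmult_indicator) (auto simp: emeasure_eq_measure)
    also have "\<dots> = ennreal ((log 2 t + log 2 (exp 1)) * prob {x \<in> space M. t \<le> R x}) * indicator {1<..} t"
      \<comment> \<open>Only the probability has to be nonnegative for this product rule, so a
        negative logarithmic factor at small t does no harm.\<close>
      by (subst ennreal_mult'') (auto simp: mult_ac)
    finally show "(\<integral>\<^sup>+x. ennreal (log 2 t + log 2 (exp 1)) * indicator {1<..} t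
        * indicator {x \<in> space M. t \<le> R x} x \<partial>M)
        = ennreal ((log 2 t + log 2 (exp 1)) * prob {x \<in> space M. t \<le> R x}) * indicator {1<..} t" .
  qed
  finally show ?thesis .
qed

text \<open>The tail is zero above the essential bound r, so the layer-cake integral stops there.
  The open interval matches the interval integral of the final statement.\<close>

lemma
  assumes [measurable]: "R \<in> borel_measurable M"
    and R: "\<And>x. 0 \<le> R x" "AE x in M. R x \<le> r"
  defines "F \<equiv> \<lambda>t. (log 2 t + log 2 (exp 1)) * prob {x \<in> space M. t \<le> R x}"
  shows set_integrable_entropy_tail: "set_integrable lborel {1<..<r} F"
    and entropy_le_integral_tail:
      "expectation (\<lambda>x. R x * log 2 (R x)) \<le> (LINT t:{1<..<r}|lborel. F t)"
proof -
  \<comment> \<open>Monotone functions are Borel; negation makes the tail increasing.\<close>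
  have "(\<lambda>t. prob {x \<in> space M. t \<le> R x}) \<in> borel_measurable borel"
    using borel_measurable_mono[of "\<lambda>t. - prob {x \<in> space M. t \<le> R x}"] antimono_tail[OF assms(1)]
    by (simp add: mono_def antimono_def)
  then have [measurable]: "F \<in> borel_measurable borel"
    unfolding F_def by measurable
  have F_bounds: "0 \<le> F t" "F t \<le> log 2 r + log 2 (exp 1)" if "t \<in> {1<..<r}" for t
  proof -
    have "0 \<le> log 2 (exp 1 :: real)" "0 \<le> log 2 t" "log 2 t \<le> log 2 r"
      using that by (auto simp: log_def divide_right_mono)
    then have "0 \<le> log 2 t + log 2 (exp 1)" "log 2 t + log 2 (exp 1) \<le> log 2 r + log 2 (exp 1)"
      by auto
    then show "0 \<le> F t" "F t \<le> log 2 r + log 2 (exp 1)"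
      unfolding F_def using mult_mono[of _ "log 2 r + log 2 (exp 1)" "prob {x \<in> space M. t \<le> R x}" 1]
      by fastforce+
  qed
  show int: "set_integrable lborel {1<..<r} F"
    unfolding set_integrable_def
  proof (rule integrableI_bounded_set_indicator)
    show "AE t in lborel. t \<in> {1<..<r} \<longrightarrow> norm (F t) \<le> log 2 r + log 2 (exp 1)"
      using F_bounds by auto
    show "emeasure lborel {1<..<r} < \<infinity>"
      by (cases "1 \<le> r") auto
  qed auto
  have pos: "(\<integral>\<^sup>+x. ennreal (max 1 (R x) * log 2 (max 1 (R x))) \<partial>M)
      = ennreal (LINT t:{1<..<r}|lborel. F t)"
  proof -
    have "(\<integral>\<^sup>+t. ennreal (F t) * indicator {1<..} t \<partial>lborel)
        = (\<integral>\<^sup>+t. ennreal (indicator {1<..<r} t *\<^sub>R F t) \<partial>lborel)"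
      \<comment> \<open>The two sides can differ only at t = r, where R may have an atom.\<close>
      by (intro nn_integral_cong_AE, use AE_lborel_singleton[of r] in eventually_elim)
         (auto simp: indicator_def F_def tail_eq_0[OF assms(1) R(2)])
    also have "\<dots> = ennreal (LINT t:{1<..<r}|lborel. F t)"
      unfolding set_lebesgue_integral_def using int F_bounds(1)
      by (intro nn_integral_eq_integral) (auto simp: set_integrable_def indicator_def)
    finally show ?thesis
      using nn_integral_entropy_layer_cake[OF assms(1)] by (simp add: F_def)
  qed
  have nonneg: "0 \<le> (LINT t:{1<..<r}|lborel. F t)"
    unfolding set_lebesgue_integral_def using F_bounds(1)
    by (intro integral_nonneg_AE) (auto simp: indicator_def)
  \<comment> \<open>Replacing R by \<open>max 1 R\<close> can only increase t log t, which is
    nonpositive on [0, 1] and zero at 1.\<close>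
  have "expectation (\<lambda>x. R x * log 2 (R x)) \<le> expectation (\<lambda>x. max 1 (R x) * log 2 (max 1 (R x)))"
  proof (rule integral_mono)
    show "integrable M (\<lambda>x. R x * log 2 (R x))"
      by (rule integrable_entropy[OF assms(1) R])
    show "integrable M (\<lambda>x. max 1 (R x) * log 2 (max 1 (R x)))"
      using R(2) by (intro integrable_entropy[where r = "max 1 r"]) auto
    show "R x * log 2 (R x) \<le> max 1 (R x) * log 2 (max 1 (R x))" for x
      using R(1)[of x] by (cases "R x = 0") (auto simp: max_def mult_le_0_iff)
  qed
  also have "\<dots> = (LINT t:{1<..<r}|lborel. F t)"
    using nonneg by (subst integral_eq_nn_integral) (auto simp: pos)
  finally show "expectation (\<lambda>x. R x * log 2 (R x)) \<le> (LINT t:{1<..<r}|lborel. F t)" .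
qed

end

text \<open>Translates between expectations under the uniform law on a bin and integrals over that
  bin divided by its volume.\<close>

lemma
  fixes h :: "'a::euclidean_space \<Rightarrow> real"
  assumes [measurable]: "B \<in> sets borel" "h \<in> borel_measurable borel"
    and B: "emeasure lborel B \<noteq> 0" "emeasure lborel B \<noteq> \<infinity>"
  shows integrable_uniform_lborel_iff:
      "integrable (uniform_measure lborel B) h \<longleftrightarrow> set_integrable lborel B h"
    and integral_uniform_lborel:
      "integral\<^sup>L (uniform_measure lborel B) h = (LINT x:B|lborel. h x) / measure lborel B"
proof -
  define b where "b = measure lborel B"
  have b_eq: "emeasure lborel B = ennreal b"
    using B(2) by (simp add: b_def emeasure_eq_ennreal_measure)
  with B(1) have b: "0 < b"
    by (metis b_def ennreal_0 measure_nonneg order_less_le)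
  \<comment> \<open>\<open>uniform_measure\<close> divides in \<open>ennreal\<close>; the Bochner
    integral rules expect a real-valued density.\<close>
  have "indicator B x / emeasure lborel B = ennreal (indicator B x / b)" for x
    using divide_ennreal[of "indicator B x" b] b unfolding b_eq by (simp add: ennreal_indicator)
  then have eq: "uniform_measure lborel B = density lborel (\<lambda>x. ennreal (indicator B x / b))"
    unfolding uniform_measure_def by simp
  have scale: "(\<lambda>x. (indicator B x / b) *\<^sub>R h x) = (\<lambda>x. (1 / b) * (indicator B x *\<^sub>R h x))"
    by (simp add: fun_eq_iff)
  have "integrable (uniform_measure lborel B) h \<longleftrightarrow> integrable lborel (\<lambda>x. (indicator B x / b) *\<^sub>R h x)"
    unfolding eq using b by (intro integrable_density) auto
  also have "\<dots> \<longleftrightarrow> set_integrable lborel B h"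
    unfolding scale set_integrable_def using b by (subst integrable_mult_left_iff) simp
  finally show "integrable (uniform_measure lborel B) h \<longleftrightarrow> set_integrable lborel B h" .
  have "integral\<^sup>L (uniform_measure lborel B) h = (\<integral>x. (indicator B x / b) *\<^sub>R h x \<partial>lborel)"
    unfolding eq using b by (intro integral_density) auto
  also have "\<dots> = (1 / b) * (LINT x:B|lborel. h x)"
    unfolding scale set_lebesgue_integral_def by (rule integral_mult_right_zero)
  finally show "integral\<^sup>L (uniform_measure lborel B) h = (LINT x:B|lborel. h x) / measure lborel B"
    by (simp add: b_def)
qed

section \<open>Floating-point bins\<close>

text \<open>The range has length 2 * 2 powr (E - 1) - 1 = 2^E - 1. This holds for E = 0 too, where
  both ends equal 1/2.\<close>

lemma exponents_eq: "exponents E = (\<lambda>k. e_min E + real k) ` {..<2 ^ E}"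
proof -
  have "2 * 2 powr (real E - 1) = 2 powr real E"
    by (simp add: powr_diff)
  then have "e_min E + real k \<le> e_max E \<longleftrightarrow> real (Suc k) \<le> real (2 ^ E)" for k
    by (simp add: e_min_def e_max_def powr_realpow algebra_simps)
  then show ?thesis
    by (auto simp: exponents_def less_eq_Suc_le simp del: of_nat_Suc of_nat_power)
qed

text \<open>The exponent is given by its natural-number offset from \<open>e_min\<close>, so that
  exponents can be counted and compared as naturals although \<open>e_min\<close> is real.\<close>

definition fp_magnitude :: "nat \<Rightarrow> nat \<Rightarrow> nat \<Rightarrow> nat \<Rightarrow> real" where
  "fp_magnitude E p k m = 2 powr (e_min E + real k) * (1 + real m * 2 powr (- (real p - 1)))"

lemma fp_values_eq:
  "fp_values E p = (\<lambda>(s, k, m). s * fp_magnitude E p k m) ` ({-1, 1} \<times> {..<2 ^ E} \<times> {..<2 ^ (p - 1)})"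
  unfolding fp_values_def exponents_eq fp_magnitude_def by (fastforce simp: image_iff)

lemma finite_fp_values: "finite (fp_values E p)"
  by (simp add: fp_values_eq)

lemma fp_magnitude_pos: "0 < fp_magnitude E p k m"
  unfolding fp_magnitude_def by (intro mult_pos_pos add_pos_nonneg) auto

text \<open>Coordinate hyperplanes are negligible, and being Borel they are null for
  \<open>lborel\<close> itself, not merely for its completion.\<close>

lemma AE_lborel_vec_nth_neq: "AE x in (lborel :: (real ^ 'n) measure). x $ k \<noteq> c"
proof -
  have "negligible {x :: real ^ 'n. x $ k = c}"
    by (simp add: cart_eq_inner_axis negligible_standard_hyperplane)
  moreover have "{x :: real ^ 'n. x $ k = c} \<in> sets borel"
    by (intro borel_closed closed_Collect_eq continuous_intros)
  ultimately have "{x :: real ^ 'n. x $ k = c} \<in> null_sets lborel"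
    by (simp add: negligible_iff_null_sets null_sets_completion_iff)
  then show ?thesis
    by (auto intro: AE_I')
qed

section \<open>Order of the representable values and of the bin boundaries\<close>

context
  fixes E p :: nat
  assumes p: "1 \<le> p"
begin

lemma mantissa_le:
  assumes "m < 2 ^ (p - 1)"
  shows "real m * 2 powr (- (real p - 1)) \<le> 1 - 2 powr (- (real p - 1))"
proof -
  have "real (Suc m) \<le> real (2 ^ (p - 1))"
    using assms by (intro of_nat_mono) simp
  also have "\<dots> = 2 powr (real p - 1)"
    using p by (simp add: powr_realpow[symmetric] of_nat_diff)
  finally have "real (Suc m) * 2 powr (- (real p - 1)) \<le> 2 powr (real p - 1) * 2 powr (- (real p - 1))"
    by (intro mult_right_mono) auto
  also have "\<dots> = 1"
    by (simp add: powr_add[symmetric])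
  finally show ?thesis
    by (simp add: algebra_simps)
qed

text \<open>Binades do not overlap: a magnitude lies below twice its power of two, and the next
  binade starts there.\<close>

lemma fp_magnitude_exponent_less:
  assumes "m < 2 ^ (p - 1)" "k < k'"
  shows "fp_magnitude E p k m < fp_magnitude E p k' m'"
proof -
  have "fp_magnitude E p k m < 2 powr (e_min E + real k) * 2"
    unfolding fp_magnitude_def using mantissa_le[OF assms(1)]
    by (intro mult_strict_left_mono) (auto intro: le_less_trans)
  also have "\<dots> = 2 powr (e_min E + real (Suc k))"
    by (simp add: powr_add)
  also have "\<dots> \<le> 2 powr (e_min E + real k')"
    using assms(2) by (intro powr_mono) auto
  also have "\<dots> \<le> fp_magnitude E p k' m'"
    unfolding fp_magnitude_def by simp
  finally show ?thesis .
qed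

lemma fp_magnitude_eq_iff:
  assumes "m < 2 ^ (p - 1)" "m' < 2 ^ (p - 1)"
  shows "fp_magnitude E p k m = fp_magnitude E p k' m' \<longleftrightarrow> k = k' \<and> m = m'"
proof (cases "k = k'")
  case True
  then show ?thesis by (simp add: fp_magnitude_def)
next
  case False
  then show ?thesis
    using fp_magnitude_exponent_less[OF assms(1), of k k' m']
      fp_magnitude_exponent_less[OF assms(2), of k' k m] by linarith
qed

text \<open>Positive magnitudes separate the signs, giving 2 * 2^E * 2^(p-1) distinct values. Hence
  the indices from 1 to \<open>fp_count E p\<close> are valid positions in the sorted list.\<close>

lemma card_fp_values: "card (fp_values E p) = fp_count E p"
proof -
  have "inj_on (\<lambda>(s, k, m). s * fp_magnitude E p k m)
      ({-1, 1} \<times> {..<2 ^ E} \<times> {..<2 ^ (p - 1)})"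
  proof (rule inj_onI)
    fix x y :: "real \<times> nat \<times> nat"
    assume mem: "x \<in> {-1, 1} \<times> {..<2 ^ E} \<times> {..<2 ^ (p - 1)}" "y \<in> {-1, 1} \<times> {..<2 ^ E} \<times> {..<2 ^ (p - 1)}"
      and eq: "(\<lambda>(s, k, m). s * fp_magnitude E p k m) x = (\<lambda>(s, k, m). s * fp_magnitude E p k m) y"
    obtain s k m s' k' m' where xy: "x = (s, k, m)" "y = (s', k', m')"
      by (metis prod_cases3)
    from mem eq have "s = s'"
      using fp_magnitude_pos[of E p k m] fp_magnitude_pos[of E p k' m'] by (auto simp: xy)
    with mem eq show "x = y"
      by (auto simp: xy fp_magnitude_eq_iff)
  qed
  then have "card (fp_values E p) = 2 * (2 ^ E * 2 ^ (p - 1))"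
    unfolding fp_values_eq by (subst card_image) (auto simp: card_cartesian_product)
  also have "\<dots> = fp_count E p"
    using p by (cases p) (auto simp: fp_count_def power_add)
  finally show ?thesis .
qed

lemma abs_fp_values_le:
  assumes "v \<in> fp_values E p"
  shows "\<bar>v\<bar> \<le> granular_max E p"
proof -
  obtain s k m where *: "s \<in> {-1, 1}" "e_min E + real k \<in> exponents E" "m < 2 ^ (p - 1)"
    and v: "v = s * fp_magnitude E p k m"
    using assms unfolding fp_values_eq exponents_eq by auto
  have "\<bar>v\<bar> = fp_magnitude E p k m"
    using *(1) fp_magnitude_pos[of E p k m] by (auto simp: v abs_mult)
  \<comment> \<open>The largest value is 2 powr e_max * (2 - 2 powr (1 - p)); the granular region
    extends half a spacing, 2 powr (e_max - p), beyond it.\<close>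
  also have "\<dots> \<le> 2 powr e_max E * (2 - 2 powr - real p)"
    unfolding fp_magnitude_def
  proof (intro mult_mono)
    show "2 powr (e_min E + real k) \<le> 2 powr e_max E"
      using *(2) by (intro powr_mono) (auto simp: exponents_def)
    have "2 powr - real p \<le> 2 powr (- (real p - 1))"
      by (intro powr_mono) auto
    then show "1 + real m * 2 powr (- (real p - 1)) \<le> 2 - 2 powr - real p"
      using mantissa_le[OF *(3)] by linarith
  qed auto
  also have "\<dots> = granular_max E p"
    by (simp add: granular_max_def powr_add powr_diff powr_minus field_simps)
  finally show ?thesis .
qed

lemma abs_fp_value_le:
  assumes "1 \<le> i" "i \<le> fp_count E p"
  shows "\<bar>fp_value E p i\<bar> \<le> granular_max E p"
proof -
  have "fp_value E p i \<in> set (sorted_list_of_set (fp_values E p))"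
    unfolding fp_value_def using assms by (intro nth_mem) (auto simp: card_fp_values)
  then show ?thesis
    by (intro abs_fp_values_le) (simp add: finite_fp_values)
qed

lemma fp_value_mono:
  assumes "i \<le> j" "1 \<le> j" "j \<le> fp_count E p"
  shows "fp_value E p i \<le> fp_value E p j"
  unfolding fp_value_def using assms
  by (intro sorted_nth_mono) (auto simp: card_fp_values)

lemma bin_lower_ge:
  assumes "i \<in> {1..fp_count E p}"
  shows "- granular_max E p \<le> bin_lower E p i"
proof (cases "i = 1")
  case True
  then show ?thesis by (simp add: bin_lower_def)
next
  case False
  with assms have "1 \<le> i - 1" "i - 1 \<le> fp_count E p" by auto
  with False assms show ?thesis
    using abs_fp_value_le[of i] abs_fp_value_le[of "i - 1"] by (auto simp: bin_lower_def)
qed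

lemma bin_upper_le:
  assumes "i \<in> {1..fp_count E p}"
  shows "bin_upper E p i \<le> granular_max E p"
  using assms abs_fp_value_le[of i] abs_fp_value_le[of "i + 1"] by (auto simp: bin_upper_def)

lemma bin_upper_le_lower:
  assumes "i \<in> {1..fp_count E p}" "j \<in> {1..fp_count E p}" "i < j"
  shows "bin_upper E p i \<le> bin_lower E p j"
proof -
  \<comment> \<open>Since i < j, i is not the last index and j is not the first, so both boundaries
    are midpoints and their summands can be compared one by one.\<close>
  have "i + 1 \<le> j" "i \<le> j - 1" "1 \<le> j - 1" "j - 1 \<le> fp_count E p"
    using assms by auto
  then show ?thesis
    using assms fp_value_mono[of "i + 1" j] fp_value_mono[of i "j - 1"]
    by (auto simp: bin_upper_def bin_lower_def)
qed

lemma fp_bin_subset_granular_box: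
  assumes "i \<in> bin_indices E p"
  shows "fp_bin E p i \<subseteq> granular_box E p"
  using assms bin_lower_ge bin_upper_le
  unfolding fp_bin_def granular_box_def granular_region_def bin_indices_def
  by clarsimp (meson order_trans atLeastAtMost_iff)

text \<open>A point of two bins whose indices differ in coordinate k has its k-th coordinate equal
  to a lower bin boundary. This confines it to finitely many null hyperplanes.\<close>

lemma AE_fp_bin_unique:
  "AE x in (lborel :: (real ^ 'n) measure). \<forall>i\<in>bin_indices E p. \<forall>j\<in>bin_indices E p.
     x \<in> fp_bin E p i \<longrightarrow> x \<in> fp_bin E p j \<longrightarrow> i = j"
proof -
  have "AE x in (lborel :: (real ^ 'n) measure). \<forall>k. \<forall>n\<in>{1..fp_count E p}. x $ k \<noteq> bin_lower E p n"
    by (intro AE_all_countable[THEN iffD2] AE_finite_allI allI AE_lborel_vec_nth_neq) auto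
  then show ?thesis
  proof eventually_elim
    case (elim x)
    have "i k = j k" if i: "i \<in> bin_indices E p" "x \<in> fp_bin E p i"
      and j: "j \<in> bin_indices E p" "x \<in> fp_bin E p j" for i j k
    proof (rule ccontr)
      assume "i k \<noteq> j k"
      then consider "i k < j k" | "j k < i k" by linarith
      moreover have "i k \<in> {1..fp_count E p}" "j k \<in> {1..fp_count E p}"
        "x $ k \<in> {bin_lower E p (i k)..bin_upper E p (i k)}"
        "x $ k \<in> {bin_lower E p (j k)..bin_upper E p (j k)}"
        using i j by (auto simp: bin_indices_def fp_bin_def)
      ultimately have "x $ k = bin_lower E p (j k) \<or> x $ k = bin_lower E p (i k)"
        using bin_upper_le_lower[of "i k" "j k"] bin_upper_le_lower[of "j k" "i k"]
        by cases auto
      with elim \<open>i k \<in> _\<close> \<open>j k \<in> _\<close> show False by blast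
    qed
    then show ?case by blast
  qed
qed

end

lemma fp_bin_eq_cbox:
  "fp_bin E p i = cbox (\<chi> j. bin_lower E p (i j)) (\<chi> j. bin_upper E p (i j))"
  by (auto simp: fp_bin_def mem_box_cart)

lemma finite_bin_indices: "finite (bin_indices E p :: ('n::finite \<Rightarrow> nat) set)"
proof -
  have "bin_indices E p = (UNIV \<rightarrow>\<^sub>E {1..fp_count E p} :: ('n \<Rightarrow> nat) set)"
    by (auto simp: bin_indices_def PiE_def)
  then show ?thesis
    by (simp add: finite_PiE)
qed

section \<open>The divergence as a sum over bins\<close>

lemma sets_fp_bin [measurable]: "fp_bin E p i \<in> sets borel"
  by (simp add: fp_bin_eq_cbox)

lemma emeasure_fp_bin_finite: "emeasure lborel (fp_bin E p i) \<noteq> \<infinity>"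
  by (simp add: fp_bin_eq_cbox emeasure_lborel_cbox_eq)

section \<open>The density of X and the bin probabilities\<close>

context
  fixes M :: "'a measure" and X :: "'a \<Rightarrow> real ^ 'n" and f :: "real ^ 'n \<Rightarrow> real"
  assumes M: "prob_space M"
    and nonneg: "\<And>x. 0 \<le> f x"
    and dist: "distributed M lborel X (\<lambda>x. ennreal (f x))"
begin

text \<open>\<open>distributed\<close> gives measurability of f only as an \<open>ennreal\<close>
  function; nonnegativity lets \<open>enn2real\<close> recover f.\<close>

lemma density_measurable: "f \<in> borel_measurable borel"
proof -
  have "(\<lambda>x. enn2real (ennreal (f x))) \<in> borel_measurable lborel"
    using distributed_borel_measurable[OF dist] by measurable
  then show ?thesis
    by (simp add: nonneg)
qed

lemma integrable_density_fun: "integrable lborel f"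
proof (rule integrableI_nonneg)
  interpret prob_space M by (rule M)
  have "(\<integral>\<^sup>+x. ennreal (f x) \<partial>lborel) = emeasure M (X -` UNIV \<inter> space M)"
    by (subst distributed_emeasure[OF dist]) auto
  then show "(\<integral>\<^sup>+x. ennreal (f x) \<partial>lborel) < \<infinity>"
    by (simp add: emeasure_space_1)
qed (use density_measurable nonneg in auto)

lemma bin_prob_eq_integral: "bin_prob M X E p i = (LINT x:fp_bin E p i|lborel. f x)"
proof -
  note [measurable] = density_measurable
  have "emeasure M (X -` fp_bin E p i \<inter> space M)
      = (\<integral>\<^sup>+x. ennreal (indicator (fp_bin E p i) x *\<^sub>R f x) \<partial>lborel)"
    by (subst distributed_emeasure[OF dist])
       (auto intro!: nn_integral_cong simp: indicator_def)
  moreover have "{\<omega> \<in> space M. X \<omega> \<in> fp_bin E p i} = X -` fp_bin E p i \<inter> space M"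
    by auto
  ultimately show ?thesis
    unfolding bin_prob_def set_lebesgue_integral_def measure_def
    by (subst integral_eq_nn_integral) (auto simp: nonneg)
qed

section \<open>A single active bin as a probability space\<close>

context
  fixes E p :: nat and i :: "'n \<Rightarrow> nat"
  assumes active: "i \<in> active_indices M X E p"
    and esssup: "ratio_esssup M X f E p i < \<infinity>"
begin

private abbreviation "B \<equiv> fp_bin E p i"
private abbreviation "U \<equiv> uniform_measure lborel B"
private abbreviation "R \<equiv> density_ratio M X f E p i"

private lemma bin_prob_pos: "0 < bin_prob M X E p i"
  using active by (simp add: active_indices_def)

text \<open>Absolute continuity: a bin of volume zero would have probability zero.\<close>

private lemma emeasure_bin_nonzero: "emeasure lborel B \<noteq> 0"
proof
  assume "emeasure lborel B = 0"
  then have "AE x in lborel. indicator B x *\<^sub>R f x = 0"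
    by (intro AE_I'[of B]) (auto simp: null_sets_def indicator_def)
  then have "(LINT x:B|lborel. f x) = 0"
    unfolding set_lebesgue_integral_def by (rule integral_eq_zero_AE)
  with bin_prob_pos show False
    by (simp add: bin_prob_eq_integral)
qed

private lemma measure_bin_pos: "0 < measure lborel B"
  using emeasure_bin_nonzero emeasure_fp_bin_finite[of E p i]
  by (simp add: measure_def enn2real_positive_iff less_top zero_less_iff_neq_zero)

private lemma bin_density_pos: "0 < bin_density M X E p i"
  using bin_prob_pos measure_bin_pos by (simp add: bin_density_def)

private lemma R_measurable [measurable]: "R \<in> borel_measurable borel"
  using density_measurable unfolding density_ratio_def by measurable

private lemma R_nonneg: "0 \<le> R x"
  using nonneg bin_density_pos by (simp add: density_ratio_def order_less_imp_le)

interpretation U: prob_space U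
  by (rule prob_space_uniform_measure[OF emeasure_bin_nonzero emeasure_fp_bin_finite])

private lemmas U_integrable_iff =
  integrable_uniform_lborel_iff[OF sets_fp_bin _ emeasure_bin_nonzero emeasure_fp_bin_finite]
private lemmas U_integral =
  integral_uniform_lborel[OF sets_fp_bin _ emeasure_bin_nonzero emeasure_fp_bin_finite]

private lemma R_integrable: "integrable U R"
proof -
  have "set_integrable lborel B f"
    unfolding set_integrable_def by (rule integrable_mult_indicator[OF _ integrable_density_fun]) simp
  then show ?thesis
    unfolding U_integrable_iff[OF R_measurable] density_ratio_def by (intro set_integrable_divide) auto
qed

text \<open>The constant g on the bin is by definition the mean of f there.\<close>

private lemma R_expectation: "U.expectation R = 1"
  unfolding U_integral[OF R_measurable] density_ratio_def
  using bin_prob_pos measure_bin_pos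
  by (simp add: bin_prob_eq_integral[symmetric] bin_density_def)

private lemma ratio_tail_eq: "ratio_tail M X f E p i t = U.prob {x \<in> space U. t \<le> R x}"
proof -
  have "{x \<in> B. t \<le> R x} = B \<inter> {x \<in> space U. t \<le> R x}"
    by auto
  then show ?thesis
    unfolding ratio_tail_def
    by (subst measure_uniform_measure)
       (use emeasure_bin_nonzero emeasure_fp_bin_finite in auto)
qed

text \<open>The mean 1 of R cannot exceed its essential bound, which puts the upper limit of
  integration at or above 1.\<close>

private lemma ratio_esssup_real:
  obtains r where "ratio_esssup M X f E p i = ereal r" "1 \<le> r" "AE x in U. R x \<le> r"
proof -
  have "AE x in restrict_space lborel B. ereal (R x) \<le> ratio_esssup M X f E p i"
    unfolding ratio_esssup_def by (rule esssup_AE)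
  then have "AE x in lborel. x \<in> B \<longrightarrow> ereal (R x) \<le> ratio_esssup M X f E p i"
    by (subst (asm) AE_restrict_space_iff) auto
  then have AE: "AE x in U. ereal (R x) \<le> ratio_esssup M X f E p i"
    by (rule AE_uniform_measureI[rotated]) simp
  \<comment> \<open>An almost sure property holds at some point, so the bound dominates a real
    number and is not minus infinity.\<close>
  then obtain x where "ereal (R x) \<le> ratio_esssup M X f E p i"
    using eventually_happens'[OF U.ae_filter_bot] by blast
  then obtain r where r: "ratio_esssup M X f E p i = ereal r"
    using esssup by (cases "ratio_esssup M X f E p i") auto
  with AE have AE: "AE x in U. R x \<le> r"
    by simp
  then have "U.expectation R \<le> r"
    by (intro U.integral_le_const R_integrable)
  with r AE that show thesis
    by (simp add: R_expectation)
qed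

private lemma divergence_integrand_bin_eq:
  "f x * log 2 (f x / bin_density M X E p i) = bin_density M X E p i * (R x * log 2 (R x))"
  using bin_density_pos by (simp add: density_ratio_def)

text \<open>The bin probability divided by the volume is g on the bin, and multiplying R by g gives
  back f.\<close>

private lemma entropy_bin_eq:
  "bin_prob M X E p i * U.expectation (\<lambda>x. R x * log 2 (R x))
    = (LINT x:B|lborel. f x * log 2 (f x / bin_density M X E p i))"
  unfolding divergence_integrand_bin_eq
  using measure_bin_pos by (subst U_integral) (simp_all add: bin_density_def)

lemma set_integrable_bin_divergence:
  "set_integrable lborel B (\<lambda>x. f x * log 2 (f x / bin_density M X E p i))"
proof -
  obtain r where "AE x in U. R x \<le> r"
    using ratio_esssup_real .
  then have "integrable U (\<lambda>x. R x * log 2 (R x))"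
    by (intro U.integrable_entropy) (auto simp: R_nonneg)
  then show ?thesis
    unfolding divergence_integrand_bin_eq
    by (subst (asm) U_integrable_iff) (auto intro!: set_integrable_mult_right)
qed

private lemma lower_objective_eq:
  "lower_objective M X f E p i t = entropy_gap t * U.prob {x \<in> space U. t \<le> R x}"
  by (simp add: lower_objective_def entropy_gap_def ratio_tail_eq)

text \<open>Ensures that \<open>max_over\<close> denotes a genuine maximum and not an unspecified
  value.\<close>

lemma lower_objective_attains_max: "\<exists>t. is_max_at (lower_objective M X f E p i) {1..} t"
proof -
  obtain r where r: "AE x in U. R x \<le> r"
    using ratio_esssup_real .
  show ?thesis
    unfolding lower_objective_eq[abs_def]
  proof (rule mult_antimono_attains_max)
    show "antimono (\<lambda>t. U.prob {x \<in> space U. t \<le> R x})"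
      by (rule U.antimono_tail) simp
    show "continuous (at_left t) (\<lambda>t. U.prob {x \<in> space U. t \<le> R x})" for t
      by (rule U.left_continuous_tail) simp
    show "U.prob {x \<in> space U. t \<le> R x} = 0" if "r < t" for t
      by (rule U.tail_eq_0[OF _ r that]) simp
  qed (use continuous_on_entropy_gap entropy_gap_nonneg in \<open>auto simp del: measure_uniform_measure\<close>)
qed

lemma max_lower_objective_le:
  "bin_prob M X E p i * max_over (lower_objective M X f E p i) {1..}
    \<le> (LINT x:B|lborel. f x * log 2 (f x / bin_density M X E p i))"
proof -
  obtain t where t: "is_max_at (lower_objective M X f E p i) {1..} t"
    using lower_objective_attains_max ..
  obtain r where "AE x in U. R x \<le> r"
    using ratio_esssup_real .
  then have "lower_objective M X f E p i t \<le> U.expectation (\<lambda>x. R x * log 2 (R x))"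
    unfolding lower_objective_eq using t
    by (intro U.entropy_gap_tail_le[OF _ R_nonneg _ R_integrable R_expectation])
       (auto simp: is_max_at_def)
  with bin_prob_pos show ?thesis
    unfolding entropy_bin_eq[symmetric] max_over_eq[OF t]
    by (intro mult_left_mono) auto
qed

private lemma upper_integrand_eq:
  "upper_integrand M X f E p i = (\<lambda>t. (log 2 t + log 2 (exp 1)) * U.prob {x \<in> space U. t \<le> R x})"
  by (simp add: upper_integrand_def ratio_tail_eq fun_eq_iff)

lemma upper_integrand_integrable:
  "interval_lebesgue_integrable lborel 1 (ratio_esssup M X f E p i) (upper_integrand M X f E p i)"
proof -
  obtain r where r: "ratio_esssup M X f E p i = ereal r" "1 \<le> r" "AE x in U. R x \<le> r"
    by (rule ratio_esssup_real)
  then have "set_integrable lborel {1<..<r} (upper_integrand M X f E p i)"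
    unfolding upper_integrand_eq by (intro U.set_integrable_entropy_tail R_nonneg) auto
  \<comment> \<open>As 1 <= r, the interval integral is the plain integral over the open
    interval.\<close>
  with r show ?thesis
    by (simp add: interval_lebesgue_integrable_def one_ereal_def)
qed

lemma bin_divergence_le:
  "(LINT x:B|lborel. f x * log 2 (f x / bin_density M X E p i))
    \<le> bin_prob M X E p i * (LBINT t=1..ratio_esssup M X f E p i. upper_integrand M X f E p i t)"
proof -
  obtain r where r: "ratio_esssup M X f E p i = ereal r" "1 \<le> r" "AE x in U. R x \<le> r"
    by (rule ratio_esssup_real)
  then have "U.expectation (\<lambda>x. R x * log 2 (R x)) \<le> (LINT t:{1<..<r}|lborel. upper_integrand M X f E p i t)"
    unfolding upper_integrand_eq by (intro U.entropy_le_integral_tail R_nonneg) auto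
  with r bin_prob_pos show ?thesis
    unfolding entropy_bin_eq[symmetric]
    by (intro mult_left_mono) (auto simp: interval_lebesgue_integral_def one_ereal_def)
qed

end

text \<open>Bins are closed, so on shared faces the sum adds several densities; the last hypothesis
  excludes such points.\<close>

lemma quantized_density_eq:
  assumes "i \<in> bin_indices E p" "x \<in> fp_bin E p i"
    and "\<And>j. j \<in> bin_indices E p \<Longrightarrow> x \<in> fp_bin E p j \<Longrightarrow> j = i"
  shows "quantized_density M X E p x = bin_density M X E p i"
proof -
  have "quantized_density M X E p x = (\<Sum>j\<in>bin_indices E p. if j = i then bin_density M X E p i else 0)"
    unfolding quantized_density_def
  proof (intro sum.cong refl)
    fix j :: "'n \<Rightarrow> nat" assume "j \<in> bin_indices E p"
    from assms(3)[OF this] assms(2)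
    show "bin_density M X E p j * indicator (fp_bin E p j) x = (if j = i then bin_density M X E p i else 0)"
      by (cases "x \<in> fp_bin E p j") auto
  qed
  then show ?thesis
    using assms(1) by (simp add: finite_bin_indices)
qed

lemma AE_divergence_integrand_eq_sum:
  assumes "1 \<le> p"
  shows "AE x in lborel.
    indicator (granular_box E p) x *\<^sub>R divergence_integrand f (quantized_density M X E p) x =
    (\<Sum>i\<in>active_indices M X E p.
      indicator (fp_bin E p i) x *\<^sub>R (f x * log 2 (f x / bin_density M X E p i)))"
  using AE_fp_bin_unique[OF assms, of E]
proof eventually_elim
  case (elim x)
  let ?h = "\<lambda>i. f x * log 2 (f x / bin_density M X E p i)"
  have fin: "finite (active_indices M X E p)"
    by (rule finite_subset[OF _ finite_bin_indices]) (auto simp: active_indices_def)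
  show ?case
  proof (cases "\<exists>i\<in>bin_indices E p. x \<in> fp_bin E p i")
    case True
    then obtain i where i: "i \<in> bin_indices E p" "x \<in> fp_bin E p i" ..
    then have uniq: "j = i" if "j \<in> bin_indices E p" "x \<in> fp_bin E p j" for j
      using elim that by blast
    have "(\<Sum>j\<in>active_indices M X E p. indicator (fp_bin E p j) x *\<^sub>R ?h j)
        = (\<Sum>j\<in>active_indices M X E p. if j = i then ?h i else 0)"
      using uniq i(2) by (intro sum.cong) (auto simp: indicator_def active_indices_def)
    also have "\<dots> = (if i \<in> active_indices M X E p then ?h i else 0)"
      using fin by simp
    also have "\<dots> = ?h i"
    proof (cases "i \<in> active_indices M X E p")
      case False
      \<comment> \<open>Here \<open>f x / 0 = 0\<close> and \<open>log 2 0 = 0\<close>, so inactive bins contribute nothing even where \<open>f x > 0\<close>.\<close>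
      with i(1) have "bin_prob M X E p i = 0"
        by (auto simp: active_indices_def bin_prob_def zero_less_measure_iff)
      with False show ?thesis
        by (simp add: bin_density_def log_def)
    qed simp
    finally show ?thesis
      using i fp_bin_subset_granular_box[OF assms i(1)]
      by (auto simp: divergence_integrand_def quantized_density_eq[OF i uniq] indicator_def)
  next
    case False
    \<comment> \<open>Outside all bins f x / 0 = 0 and log 2 0 = 0, so both sides vanish whether or
      not x lies in the box.\<close>
    then have "quantized_density M X E p x = 0"
      unfolding quantized_density_def by (intro sum.neutral) auto
    moreover have "(\<Sum>i\<in>active_indices M X E p. indicator (fp_bin E p i) x *\<^sub>R ?h i) = 0"
      using False by (intro sum.neutral) (auto simp: active_indices_def)
    ultimately show ?thesis
      by (simp add: divergence_integrand_def log_def)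
  qed
qed

text \<open>A finite sum of integrable bin contributions agrees almost everywhere with the
  divergence integrand, so integrability and value carry over.\<close>

lemma
  assumes "1 \<le> p" and "\<And>i. i \<in> active_indices M X E p \<Longrightarrow> ratio_esssup M X f E p i < \<infinity>"
  shows set_integrable_divergence_integrand:
      "set_integrable lborel (granular_box E p) (divergence_integrand f (quantized_density M X E p))"
    and divergence_eq_sum:
      "divergence (granular_box E p) f (quantized_density M X E p) =
       (\<Sum>i\<in>active_indices M X E p.
         LINT x:fp_bin E p i|lborel. f x * log 2 (f x / bin_density M X E p i))"
proof -
  let ?d = "\<lambda>x. indicator (granular_box E p) x *\<^sub>R divergence_integrand f (quantized_density M X E p) x"
  let ?s = "\<lambda>i x. indicator (fp_bin E p i) x *\<^sub>R (f x * log 2 (f x / bin_density M X E p i))"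
  note [measurable] = density_measurable
  have s: "integrable lborel (?s i)" if "i \<in> active_indices M X E p" for i
    using set_integrable_bin_divergence[OF that assms(2)[OF that]] by (simp add: set_integrable_def)
  have [measurable]: "granular_box E p \<in> sets (borel :: (real ^ 'n) measure)"
  proof -
    have "granular_box E p = cbox (\<chi> j. - granular_max E p) (\<chi> j. granular_max E p :: real ^ 'n)"
      by (auto simp: granular_box_def granular_region_def mem_box_cart)
    then show ?thesis by simp
  qed
  have [measurable]: "quantized_density M X E p \<in> borel_measurable borel"
    unfolding quantized_density_def[abs_def] by measurable
  have d: "?d \<in> borel_measurable lborel"
    unfolding divergence_integrand_def by measurable
  have eq: "AE x in lborel. (\<Sum>i\<in>active_indices M X E p. ?s i x) = ?d x"
    using AE_divergence_integrand_eq_sum[OF assms(1), of E] by eventually_elim (rule sym)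
  have sum: "integrable lborel (\<lambda>x. \<Sum>i\<in>active_indices M X E p. ?s i x)"
    using s by (rule Bochner_Integration.integrable_sum)
  then show "set_integrable lborel (granular_box E p) (divergence_integrand f (quantized_density M X E p))"
    unfolding set_integrable_def
    using d eq by (rule integrable_cong_AE_imp)
  have "divergence (granular_box E p) f (quantized_density M X E p)
      = (\<integral>x. (\<Sum>i\<in>active_indices M X E p. ?s i x) \<partial>lborel)"
    unfolding divergence_def set_lebesgue_integral_def
    by (rule integral_cong_AE[OF d borel_measurable_integrable[OF sum]
          AE_divergence_integrand_eq_sum[OF assms(1)]])
  also have "\<dots> = (\<Sum>i\<in>active_indices M X E p. integral\<^sup>L lborel (?s i))"
    using s by (rule Bochner_Integration.integral_sum)
  finally show "divergence (granular_box E p) f (quantized_density M X E p) =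
      (\<Sum>i\<in>active_indices M X E p.
        LINT x:fp_bin E p i|lborel. f x * log 2 (f x / bin_density M X E p i))"
    unfolding set_lebesgue_integral_def .
qed

end

section \<open>Both bounds, summed over the active bins\<close>

theorem theorem1:
  fixes M :: "'a measure"
    and X :: "'a \<Rightarrow> real ^ 'n"
    and f :: "real ^ 'n \<Rightarrow> real"
    and p E :: nat
  assumes "prob_space M"
    and "p \<ge> 1"
    and "\<And>x. f x \<ge> 0"
    and "distributed M lborel X (\<lambda>x. ennreal (f x))"
    and "\<And>i. i \<in> active_indices M X E p \<Longrightarrow> ratio_esssup M X f E p i < \<infinity>"
  shows
    "set_integrable lborel (granular_box E p)
       (divergence_integrand f (quantized_density M X E p)) \<and>
     (\<forall>i\<in>active_indices M X E p. \<exists>t. is_max_at (lower_objective M X f E p i) {1..} t) \<and>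
     (\<forall>i\<in>active_indices M X E p.
        interval_lebesgue_integrable lborel 1 (ratio_esssup M X f E p i)
          (upper_integrand M X f E p i)) \<and>
     (\<Sum>i\<in>active_indices M X E p.
        bin_prob M X E p i * max_over (lower_objective M X f E p i) {1..})
       \<le> divergence (granular_box E p) f (quantized_density M X E p) \<and>
     divergence (granular_box E p) f (quantized_density M X E p)
       \<le> (\<Sum>i\<in>active_indices M X E p.
            bin_prob M X E p i *
            (LBINT t=1..ratio_esssup M X f E p i. upper_integrand M X f E p i t))"
proof -
  note density = assms(1,3,4)
  have integrable: "set_integrable lborel (granular_box E p)
      (divergence_integrand f (quantized_density M X E p))"
    by (rule set_integrable_divergence_integrand[OF density assms(2)]) (rule assms(5))
  have sum: "divergence (granular_box E p) f (quantized_density M X E p) =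
      (\<Sum>i\<in>active_indices M X E p.
        LINT x:fp_bin E p i|lborel. f x * log 2 (f x / bin_density M X E p i))"
    by (rule divergence_eq_sum[OF density assms(2)]) (rule assms(5))
  show ?thesis
    \<comment> \<open>With the divergence split over the bins, both inequalities reduce to one
      comparison per bin.\<close>
    unfolding sum using integrable assms(5)
    by (intro conjI ballI sum_mono)
      (simp_all add: lower_objective_attains_max[OF density] upper_integrand_integrable[OF density]
        max_lower_objective_le[OF density] bin_divergence_le[OF density])
qed

end
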